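(* For $n \geq 4$ and $k \geq 2$ we have $ex(n;k) = \lfloor \frac{n^2}{4} \rfloor$, and for $n \geq 7$ every $2$-geodetic digraph on $n$ vertices with $ex(n;2)$ arcs is an orientation of the complete balanced bipartite graph $K_{\lceil \frac{n}{2} \rceil, \lfloor \frac{n}{2} \rfloor}$.
   Context: A digraph has a vertex set and an arc set consisting of ordered pairs of distinct vertices. A walk of length $\ell$ is a sequence $x_0x_1\dots x_\ell$ of vertices with $x_i \rightarrow x_{i+1}$ for all $i$. A digraph is $k$-geodetic if for every ordered pair $(u,v)$ of (not necessarily distinct) vertices there is at most one $u,v$-walk of length at most $k$. For $n,k\ge 2$, $ex(n;k)$ is the largest possible number of arcs of a $k$-geodetic digraph on $n$ vertices. An orientation of an undirected graph is obtained by assigning a direction to each edge. *)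

theory Defs
  imports Complex_Main "Graph_Theory.Graph_Theory"
begin

text \<open>
  A \<^emph>\<open>digraph\<close> (finite, arcs are ordered pairs of distinct vertices) is \<^const>\<open>pair_digraph\<close>.
  A walk is its vertex sequence (\<^const>\<open>vwalk\<close>). The one-vertex walk of length 0 is a walk from
  \<open>u\<close> to \<open>u\<close>, so a \<open>k\<close>-geodetic digraph has no closed walk of length between 1 and \<open>k\<close>.
\<close>

definition k_geodetic :: "nat \<Rightarrow> 'a pair_pre_digraph \<Rightarrow> bool" where
  "k_geodetic k D \<longleftrightarrow>
     (\<forall>u \<in> pverts D. \<forall>v \<in> pverts D.
        \<exists>\<^sub>\<le>\<^sub>1 p. vwalk p (with_proj D) \<and> hd p = u \<and> last p = v \<and> vwalk_length p \<le> k)"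

text \<open>
  Being a property of isomorphism classes, the extremal number may be computed over digraphs with
  natural numbers as vertices. The lemmas below show that the maximum is well defined.
\<close>

definition geodetic_sizes :: "nat \<Rightarrow> nat \<Rightarrow> nat set" where
  "geodetic_sizes n k =
     {card (parcs D) | D :: nat pair_pre_digraph.
        pair_digraph D \<and> card (pverts D) = n \<and> k_geodetic k D}"

definition ex_geodetic :: "nat \<Rightarrow> nat \<Rightarrow> nat" where
  "ex_geodetic n k = Max (geodetic_sizes n k)"

text \<open>
  As in the library, an undirected graph is a symmetric digraph \<open>H\<close>; an edge joining \<open>u\<close> and \<open>v\<close>
  is the pair of arcs \<open>(u, v)\<close>, \<open>(v, u)\<close>, exactly one of which is kept.
\<close>

definition orientation_of :: "'a pair_pre_digraph \<Rightarrow> 'a pair_pre_digraph \<Rightarrow> bool" where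
  "orientation_of D H \<longleftrightarrow>
     pair_graph H \<and> pverts D = pverts H \<and> parcs D \<subseteq> parcs H \<and>
     (\<forall>u v. (u, v) \<in> parcs H \<longrightarrow> ((u, v) \<in> parcs D) \<noteq> ((v, u) \<in> parcs D))"

lemma finite_geodetic_sizes: "finite (geodetic_sizes n k)"
proof (rule finite_subset)
  show "geodetic_sizes n k \<subseteq> {..n * n}"
  proof
    fix m assume "m \<in> geodetic_sizes n k"
    then obtain D :: "nat pair_pre_digraph"
      where D: "pair_digraph D" "card (pverts D) = n" "m = card (parcs D)"
      unfolding geodetic_sizes_def by blast
    interpret pair_digraph D by (rule D(1))
    have "parcs D \<subseteq> pverts D \<times> pverts D"
      using in_arcsD1 in_arcsD2 by auto
    then have "card (parcs D) \<le> card (pverts D \<times> pverts D)"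
      using pair_finite_verts by (intro card_mono) auto
    then show "m \<in> {..n * n}" using D by (simp add: card_cartesian_product)
  qed
qed simp

lemma geodetic_sizes_nonempty: "geodetic_sizes n k \<noteq> {}"
proof -
  let ?D = "\<lparr>pverts = {..<n}, parcs = {}\<rparr>"
  have "pair_digraph ?D" by unfold_locales auto
  moreover have "k_geodetic k ?D"
  proof -
    have "p = [hd p]" if "vwalk p (with_proj ?D)" for p
      using that by (cases p rule: vwalk_arcs.cases) (auto simp: vwalk_def)
    then show ?thesis
      unfolding k_geodetic_def Uniq_def by metis
  qed
  ultimately have "card (parcs ?D) \<in> geodetic_sizes n k"
    unfolding geodetic_sizes_def by fastforce
  then show ?thesis by blast
qed

end

theory Submission
  imports Defs
begin

text \<open>
  In a 2-geodetic digraph every triangle of the underlying graph is a directed cycle, and two such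
  triangles cannot share an edge. Hence a vertex outside a triangle has at most one neighbour in it,
  so that deleting a triangle from a graph of order \<open>n\<close> destroys at most \<open>n\<close> edges. Induction in
  steps of three gives the bound \<open>n\<^sup>2 / 4\<close>, which is strict for \<open>n \<ge> 7\<close> if there is a triangle.
  Triangle-free graphs are handled by Mantel's theorem together with its equality case: if \<open>N\<close> is
  the neighbourhood of a vertex of maximum degree \<open>d\<close>, then \<open>N\<close> is independent and the edges
  are covered by the \<open>n - d\<close> vertices outside of \<open>N\<close>. For the lower bound, direct all edges of the
  balanced complete bipartite graph from one class to the other.
\<close>

section \<open>Graphs in which every edge lies in at most one triangle\<close>

lemma nat_mult_diff_le_square: "4 * (d * (n - d)) \<le> (n::nat)\<^sup>2"
proof (cases "d \<le> n")
  case True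
  then obtain e where n: "n = d + e" using le_Suc_ex by blast
  have "0 \<le> (int d - int e)\<^sup>2" by simp
  then have "int (4 * (d * e)) \<le> int ((d + e)\<^sup>2)"
    by (simp add: power2_eq_square algebra_simps)
  then show ?thesis unfolding n by (simp only: of_nat_le_iff) simp
qed simp

text \<open>Each edge contributes two pairs to \<open>S\<close>, so \<open>card S\<close> is twice
  the number of edges; hence the factors 2 in the bounds below.\<close>

locale finite_graph =
  fixes V :: "'a set" and S :: "'a rel"
  assumes finite_V: "finite V"
    and S_sub: "S \<subseteq> V \<times> V"
    and S_sym: "(u, v) \<in> S \<Longrightarrow> (v, u) \<in> S"
    and S_irrefl: "(u, u) \<notin> S"
begin

lemma finite_S: "finite S"
  using finite_V S_sub finite_subset by blast

lemma card_S_swap: "card (S \<inter> X \<times> Y) = card (S \<inter> Y \<times> X)"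
proof -
  have "bij_betw prod.swap (S \<inter> X \<times> Y) (S \<inter> Y \<times> X)"
    by (rule bij_betwI[where g = prod.swap]) (auto intro: S_sym)
  then show ?thesis by (rule bij_betw_same_card)
qed

lemma card_S_split:
  assumes "T \<subseteq> V"
  shows "card S = card (S \<inter> T \<times> T) + 2 * card (S \<inter> T \<times> (V - T))
           + card (S \<inter> (V - T) \<times> (V - T))"
proof -
  let ?A = "S \<inter> T \<times> T" and ?B = "S \<inter> T \<times> (V - T)"
    and ?C = "S \<inter> (V - T) \<times> T" and ?D = "S \<inter> (V - T) \<times> (V - T)"
  have "S = ((?A \<union> ?B) \<union> ?C) \<union> ?D" using S_sub assms by blast
  then have "card S = card (((?A \<union> ?B) \<union> ?C) \<union> ?D)" by simp
  also have "\<dots> = card ?A + card ?B + card ?C + card ?D"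
  proof -
    have "card (((?A \<union> ?B) \<union> ?C) \<union> ?D) = card ((?A \<union> ?B) \<union> ?C) + card ?D"
      using finite_S by (intro card_Un_disjoint) auto
    moreover have "card ((?A \<union> ?B) \<union> ?C) = card (?A \<union> ?B) + card ?C"
      using finite_S by (intro card_Un_disjoint) auto
    moreover have "card (?A \<union> ?B) = card ?A + card ?B"
      using finite_S by (intro card_Un_disjoint) auto
    ultimately show ?thesis by simp
  qed
  finally show ?thesis using card_S_swap[of "V - T" T] by simp
qed

text \<open>Summing degrees over \<open>V - N\<close> counts each edge to \<open>N\<close> once and
  each edge inside \<open>V - N\<close> twice. The inner edges stay on the left as a surplus, which
  must vanish in the equality case.\<close>

lemma mantel_split:
  assumes "S O S \<inter> S = {}"
    and "V \<noteq> {}"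
  obtains N where "N \<subseteq> V" "S \<inter> N \<times> N = {}"
    "card S + card (S \<inter> (V - N) \<times> (V - N)) \<le> 2 * (card N * card (V - N))"
proof -
  define deg where "deg u = card (S `` {u})" for u
  have "Max (deg ` V) \<in> deg ` V" using assms(2) finite_V by (intro Max_in) auto
  then obtain v where v: "v \<in> V" "deg v = Max (deg ` V)" by auto
  have max: "deg u \<le> deg v" if "u \<in> V" for u
    using that finite_V v by simp
  define N where "N = S `` {v}"
  have N: "N \<subseteq> V" "S \<inter> N \<times> N = {}"
    using S_sub assms(1) unfolding N_def by blast+
  let ?W = "V - N"
  have "card (S \<inter> ?W \<times> N) + card (S \<inter> ?W \<times> ?W) = card (S \<inter> ?W \<times> N \<union> S \<inter> ?W \<times> ?W)"
    using finite_S by (intro card_Un_disjoint[symmetric]) auto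
  also have "S \<inter> ?W \<times> N \<union> S \<inter> ?W \<times> ?W = Sigma ?W (\<lambda>u. S `` {u})"
    using S_sub by blast
  also have "card \<dots> = (\<Sum>u\<in>?W. deg u)"
    unfolding deg_def using finite_V finite_S by (intro card_SigmaI) (auto intro: finite_Image)
  also have "\<dots> \<le> card ?W * deg v"
    using sum_bounded_above[of ?W deg "deg v"] max by simp
  finally have "card (S \<inter> ?W \<times> N) + card (S \<inter> ?W \<times> ?W) \<le> card ?W * card N"
    unfolding N_def deg_def .
  moreover have "card S = 2 * card (S \<inter> ?W \<times> N) + card (S \<inter> ?W \<times> ?W)"
    using card_S_split[OF N(1)] N(2) card_S_swap[of N ?W] by simp
  ultimately show thesis
    using N by (intro that[of N]) (auto simp: mult.commute)
qed

lemma mantel_bound: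
  assumes "S O S \<inter> S = {}"
  shows "2 * card S \<le> (card V)\<^sup>2"
proof (cases "V = {}")
  case True
  then show ?thesis using S_sub by auto
next
  case False
  from mantel_split[OF assms False] obtain N where N: "N \<subseteq> V"
    "card S + card (S \<inter> (V - N) \<times> (V - N)) \<le> 2 * (card N * card (V - N))"
    by metis
  have "card (V - N) = card V - card N"
    using N(1) finite_V by (simp add: card_Diff_subset finite_subset)
  then show ?thesis
    using N(2) nat_mult_diff_le_square[of "card N" "card V"] by simp
qed

lemma mantel_extremal:
  assumes "S O S \<inter> S = {}"
    and m: "card S = 2 * ((card V)\<^sup>2 div 4)"
  obtains X Y where "X \<union> Y = V" "X \<inter> Y = {}" "S = X \<times> Y \<union> Y \<times> X"
    "card X = card V - card V div 2" "card Y = card V div 2"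
proof (cases "V = {}")
  case True
  then show thesis using that[of "{}" "{}"] S_sub by auto
next
  case False
  from mantel_split[OF assms(1) False] obtain N where N: "N \<subseteq> V" "S \<inter> N \<times> N = {}"
    "card S + card (S \<inter> (V - N) \<times> (V - N)) \<le> 2 * (card N * card (V - N))"
    by metis
  let ?W = "V - N" let ?K = "N \<times> ?W \<union> ?W \<times> N"
  have finN: "finite N" using N(1) finite_V finite_subset by blast
  have cV: "card V = card N + card ?W"
    using N(1) finite_V finN by (simp add: card_Diff_subset card_mono)
  have "card N * card ?W \<le> (card V)\<^sup>2 div 4"
    using nat_mult_diff_le_square[of "card N" "card V"] cV by simp
  \<comment> \<open>Now \<open>card S\<close> is at most twice the product, which is at most
    \<open>card S\<close>: both estimates are tight.\<close>
  then have W0: "card (S \<inter> ?W \<times> ?W) = 0" and eq: "card N * card ?W = (card V)\<^sup>2 div 4"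
    using N(3) m by linarith+
  have "S \<inter> ?W \<times> ?W = {}" using W0 finite_S by simp
  then have sub: "S \<subseteq> ?K" using S_sub N(2) by blast
  have "card ?K = 2 * (card N * card ?W)"
    using finite_V finN by (subst card_Un_disjoint) (auto simp: card_cartesian_product)
  then have S: "S = ?K"
    using sub finite_V finN m eq by (intro card_subset_eq) auto
  \<comment> \<open>The floor loses less than 4, so (a + b)^2 - 4ab = (a - b)^2 < 4 and the classes
    differ in size by at most one. Integers avoid truncated subtraction.\<close>
  define a b where "a = int (card N)" and "b = int (card ?W)"
  have "(card V)\<^sup>2 < 4 * (card N * card ?W) + 4" unfolding eq by simp
  then have "int ((card N + card ?W)\<^sup>2) < int (4 * (card N * card ?W) + 4)"
    unfolding cV by (simp only: of_nat_less_iff)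
  then have "(a - b)\<^sup>2 < 2\<^sup>2"
    unfolding a_def b_def by (simp add: power2_eq_square algebra_simps)
  then have "\<bar>a - b\<bar> < 2"
    by (metis abs_numeral abs_square_less_1 power2_less_imp_less power2_abs zero_le_numeral)
  then have "card N = card V - card V div 2 \<and> card ?W = card V div 2 \<or>
    card ?W = card V - card V div 2 \<and> card N = card V div 2"
    unfolding a_def b_def cV by linarith
  then show thesis
  proof
    assume "card N = card V - card V div 2 \<and> card ?W = card V div 2"
    then show thesis using that[of N ?W] S N(1) by blast
  next
    assume "card ?W = card V - card V div 2 \<and> card N = card V div 2"
    then show thesis using that[of ?W N] S N(1) by blast
  qed
qed

end

section \<open>Deleting a triangle when no two triangles share an edge\<close>

locale book_free_graph = finite_graph +
  assumes book_free: "(x, y) \<in> S \<Longrightarrow> (x, z) \<in> S \<Longrightarrow> (y, z) \<in> S \<Longrightarrow>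
    (x, w) \<in> S \<Longrightarrow> (y, w) \<in> S \<Longrightarrow> z = w"
begin

lemma remove_triangle:
  assumes xyz: "(x, y) \<in> S" "(y, z) \<in> S" "(x, z) \<in> S"
  defines "W \<equiv> V - {x, y, z}"
  shows "card V = card W + 3" "card S \<le> card (S \<inter> W \<times> W) + 2 * card V"
    "book_free_graph W (S \<inter> W \<times> W)"
proof -
  let ?T = "{x, y, z}"
  have T: "?T \<subseteq> V" "x \<noteq> y" "y \<noteq> z" "x \<noteq> z"
    using xyz S_sub S_irrefl by auto
  then have "card ?T = 3" by simp
  then show cV: "card V = card W + 3"
    using T(1) finite_V card_mono[OF finite_V T(1)] unfolding W_def
    by (simp only: card_Diff_subset finite.insertI finite.emptyI)
  let ?E = "[(x, y), (y, x), (y, z), (z, y), (x, z), (z, x)]"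
  have "S \<inter> ?T \<times> ?T \<subseteq> set ?E"
    using S_irrefl by auto
  then have "card (S \<inter> ?T \<times> ?T) \<le> card (set ?E)"
    by (intro card_mono) auto
  also have "\<dots> \<le> 6" using card_length[of ?E] by simp
  finally have TT: "card (S \<inter> ?T \<times> ?T) \<le> 6" .
  \<comment> \<open>Injectivity says that no outer vertex \<open>w\<close> has two neighbours in the
    triangle: otherwise \<open>w\<close> and the third vertex of the triangle would both complete
    the edge between those neighbours.\<close>
  have "inj_on snd (S \<inter> ?T \<times> W)"
  proof (rule inj_onI, clarsimp)
    fix s t w assume "(s, w) \<in> S" "(t, w) \<in> S" "w \<in> W"
      "s = x \<or> s = y \<or> s = z" "t = x \<or> t = y \<or> t = z"
    moreover have "w \<noteq> x" "w \<noteq> y" "w \<noteq> z" using \<open>w \<in> W\<close> W_def by auto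
    moreover have "(y, x) \<in> S" "(z, y) \<in> S" "(z, x) \<in> S" using xyz S_sym by auto
    ultimately show "s = t" using xyz book_free by metis
  qed
  then have "card (S \<inter> ?T \<times> W) \<le> card W"
    using finite_V by (rule_tac card_inj_on_le) (auto simp: W_def)
  \<comment> \<open>The loss is at most 6 + 2 * (card V - 3) = 2 * card V ordered pairs.\<close>
  then show "card S \<le> card (S \<inter> W \<times> W) + 2 * card V"
    using card_S_split[OF T(1), folded W_def] TT cV by simp
  show "book_free_graph W (S \<inter> W \<times> W)"
    using finite_V
    by unfold_locales (auto simp: W_def S_irrefl intro: S_sym book_free)
qed

end

text \<open>Here \<open>2 * card S\<close> is four times the number of edges; the triangle is the exception for \<open>n = 3\<close>.\<close>

lemma book_free_bound:
  assumes "book_free_graph V S"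
  shows "2 * card S \<le> (card V)\<^sup>2 + (if card V = 3 then 3 else 0)"
  using assms
proof (induction "card V" arbitrary: V S rule: less_induct)
  case less
  interpret book_free_graph V S by (rule less.prems)
  show ?case
  proof (cases "S O S \<inter> S = {}")
    case True
    then show ?thesis using mantel_bound by fastforce
  next
    case False
    then obtain x y z where xyz: "(x, y) \<in> S" "(y, z) \<in> S" "(x, z) \<in> S" by blast
    define W where "W = V - {x, y, z}"
    define n where "n = card W"
    note rem = remove_triangle[OF xyz, folded W_def]
    have IH: "2 * card (S \<inter> W \<times> W) \<le> n\<^sup>2 + (if n = 3 then 3 else 0)"
      unfolding n_def using rem by (intro less.hyps) auto
    have cV: "card V = n + 3" using rem(1) n_def by simp
    have sq: "(n + 3)\<^sup>2 = n\<^sup>2 + 6 * n + 9" by (simp add: power2_eq_square algebra_simps)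
    have "2 * card S \<le> 2 * card (S \<inter> W \<times> W) + 4 * (n + 3)" using rem(2) cV by simp
    \<comment> \<open>For n \<ge> 2 the loss 4n + 12 fits into 6n + 9, and for n = 3 the gap of 3
      exactly absorbs the exception in \<open>IH\<close>. For n = 1 parity turns the bound 1 of
      \<open>IH\<close> into 0; n = 0 is the triangle itself.\<close>
    moreover have "n = 0 \<or> n = 1 \<or> n \<ge> 2" by linarith
    ultimately show ?thesis
      using IH unfolding cV sq by (auto split: if_splits)
  qed
qed

lemma (in book_free_graph) extremal_triangle_free:
  assumes "card V \<ge> 7" and m: "card S = 2 * ((card V)\<^sup>2 div 4)"
  shows "S O S \<inter> S = {}"
proof (rule ccontr)
  assume "S O S \<inter> S \<noteq> {}"
  then obtain x y z where xyz: "(x, y) \<in> S" "(y, z) \<in> S" "(x, z) \<in> S" by blast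
  define W where "W = V - {x, y, z}"
  define n where "n = card W"
  note rem = remove_triangle[OF xyz, folded W_def]
  have "2 * card (S \<inter> W \<times> W) \<le> n\<^sup>2 + (if n = 3 then 3 else 0)"
    unfolding n_def using rem by (intro book_free_bound) auto
  moreover have cV: "card V = n + 3" using rem(1) n_def by simp
  moreover have sq: "(n + 3)\<^sup>2 = n\<^sup>2 + 6 * n + 9" by (simp add: power2_eq_square algebra_simps)
  \<comment> \<open>Rounding down costs at most 3, so n^2 + 6n + 6 \<le> 2 * card S \<le> n^2 + 4n +
    12, impossible for n \<ge> 4. On 6 vertices the triangular prism attains 9 edges, whence the
    threshold 7.\<close>
  ultimately show False using rem(2) m assms(1) by (auto split: if_splits)
qed

section \<open>Geodetic digraphs\<close>

lemma k_geodetic_unique: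
  assumes "k_geodetic k D" "vwalk p (with_proj D)" "vwalk q (with_proj D)"
    "hd p = hd q" "last p = last q" "vwalk_length p \<le> k" "vwalk_length q \<le> k"
  shows "p = q"
proof -
  have "hd p \<in> pverts D" "last p \<in> pverts D"
    using assms(2) unfolding vwalk_def by auto
  then show ?thesis
    using assms unfolding k_geodetic_def Uniq_def by (metis (no_types))
qed

section \<open>The underlying graph of a 2-geodetic digraph\<close>

definition sym_closure :: "'a rel \<Rightarrow> 'a rel" where
  "sym_closure A = A \<union> A\<inverse>"

locale two_geodetic = pair_digraph G for G :: "'a pair_pre_digraph" +
  assumes geodetic: "k_geodetic 2 G"
begin

lemma no_2_cycle:
  assumes "(u, v) \<in> parcs G"
  shows "(v, u) \<notin> parcs G"
proof
  assume "(v, u) \<in> parcs G"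
  \<comment> \<open>The closed walk competes with the walk of length 0 at \<open>u\<close>.\<close>
  then have "[u, v, u] = [u]"
    using assms wellformed' by (intro k_geodetic_unique[OF geodetic]) (auto simp: vwalk_def)
  then show False by simp
qed

lemma no_transitive_triangle:
  assumes "(u, v) \<in> parcs G" "(v, w) \<in> parcs G"
  shows "(u, w) \<notin> parcs G"
proof
  assume "(u, w) \<in> parcs G"
  then have "[u, v, w] = [u, w]"
    using assms wellformed' by (intro k_geodetic_unique[OF geodetic]) (auto simp: vwalk_def)
  then show False by simp
qed

lemma unique_middle:
  assumes "(u, v) \<in> parcs G" "(v, w) \<in> parcs G" "(u, v') \<in> parcs G" "(v', w) \<in> parcs G"
  shows "v = v'"
proof -
  have "[u, v, w] = [u, v', w]"
    using assms wellformed' by (intro k_geodetic_unique[OF geodetic]) (auto simp: vwalk_def)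
  then show ?thesis by simp
qed

text \<open>Triangles are cyclic, so two of them on an arc from x to y would give walks from y to x
  through z and through w, and \<open>unique_middle\<close> identifies z with w.\<close>

sublocale underlying: book_free_graph "pverts G" "sym_closure (parcs G)"
proof
  fix x y z w
  assume "(x, y) \<in> sym_closure (parcs G)" "(x, z) \<in> sym_closure (parcs G)"
    "(y, z) \<in> sym_closure (parcs G)" "(x, w) \<in> sym_closure (parcs G)"
    "(y, w) \<in> sym_closure (parcs G)"
  then show "z = w"
    unfolding sym_closure_def Un_iff converse_iff
    using no_transitive_triangle unique_middle by metis
next
  show "(u, u) \<notin> sym_closure (parcs G)" for u
    unfolding sym_closure_def using no_2_cycle by blast
qed (use pair_finite_verts wellformed' in \<open>auto simp: sym_closure_def\<close>)

lemma card_sym_closure: "card (sym_closure (parcs G)) = 2 * card (parcs G)"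
  unfolding sym_closure_def using pair_finite_arcs no_2_cycle
  by (subst card_Un_disjoint) auto

lemma card_parcs_le:
  assumes "card (pverts G) \<ge> 4"
  shows "card (parcs G) \<le> (card (pverts G))\<^sup>2 div 4"
  using book_free_bound[OF underlying.book_free_graph_axioms] assms card_sym_closure by simp

end

text \<open>Walks of length at most 2 are among those of length at most k, so the upper bound for 2
  serves every larger k.\<close>

lemma two_geodeticI:
  assumes "pair_digraph D" "k_geodetic k D" "k \<ge> 2"
  shows "two_geodetic D"
proof -
  interpret pair_digraph D by fact
  show ?thesis
  proof
    show "k_geodetic 2 D"
      using assms(2,3) unfolding k_geodetic_def Uniq_def by (meson order_trans)
  qed
qed

section \<open>The lower bound and the extremal number\<close>

lemma balanced_bipartite_in_geodetic_sizes: "n\<^sup>2 div 4 \<in> geodetic_sizes n k"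
proof -
  define a where "a = n div 2"
  let ?D = "\<lparr>pverts = {..<n}, parcs = {..<a} \<times> {a..<n}\<rparr>"
  have a: "a \<le> n" unfolding a_def by simp
  have "pair_digraph ?D"
    using a by unfold_locales auto
  moreover have "k_geodetic k ?D"
  proof -
    \<comment> \<open>All arcs go from the lower to the upper class, so walks have length at most 1
      and are determined by their ends, whatever k is.\<close>
    have "p = (if hd p = last p then [hd p] else [hd p, last p])" if "vwalk p (with_proj ?D)" for p
      using that by (cases p rule: vwalk_arcs.cases; cases "tl (tl p)") (auto simp: vwalk_def)
    then show ?thesis
      unfolding k_geodetic_def Uniq_def by metis
  qed
  moreover have "card (parcs ?D) = n\<^sup>2 div 4"
  proof (cases "even n")
    case True
    then obtain b where "n = 2 * b" by blast
    then show ?thesis by (simp add: a_def card_cartesian_product power2_eq_square)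
  next
    case False
    then obtain b where n: "n = 2 * b + 1" by (auto elim: oddE)
    have "n\<^sup>2 = 4 * (b * (b + 1)) + 1"
      unfolding n by (simp add: power2_eq_square algebra_simps)
    then have "n\<^sup>2 div 4 = b * (b + 1)" by simp
    then show ?thesis by (simp add: a_def n card_cartesian_product)
  qed
  ultimately show ?thesis
    unfolding geodetic_sizes_def by (intro CollectI exI[of _ ?D]) auto
qed

lemma ex_geodetic_eq:
  assumes "n \<ge> 4" "k \<ge> 2"
  shows "ex_geodetic n k = n\<^sup>2 div 4"
  unfolding ex_geodetic_def
proof (rule Max_eqI[OF finite_geodetic_sizes])
  fix m assume "m \<in> geodetic_sizes n k"
  then obtain D :: "nat pair_pre_digraph"
    where D: "pair_digraph D" "card (pverts D) = n" "k_geodetic k D" "m = card (parcs D)"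
    unfolding geodetic_sizes_def by blast
  interpret two_geodetic D using D assms by (intro two_geodeticI)
  show "m \<le> n\<^sup>2 div 4" using card_parcs_le D assms by simp
qed (rule balanced_bipartite_in_geodetic_sizes)

section \<open>Structure of the extremal digraphs\<close>

lemma (in two_geodetic) extremal_orientation:
  assumes "card (pverts G) \<ge> 7" "card (parcs G) = (card (pverts G))\<^sup>2 div 4"
  defines "H \<equiv> \<lparr>pverts = pverts G, parcs = sym_closure (parcs G)\<rparr>"
  shows "complete_bipartite_digraph (card (pverts G) - card (pverts G) div 2)
      (card (pverts G) div 2) (with_proj H)"
    and "orientation_of G H"
proof -
  have m: "card (sym_closure (parcs G)) = 2 * ((card (pverts G))\<^sup>2 div 4)"
    using card_sym_closure assms(2) by simp
  obtain X Y where XY: "X \<union> Y = pverts G" "X \<inter> Y = {}"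
    "sym_closure (parcs G) = X \<times> Y \<union> Y \<times> X"
    "card X = card (pverts G) - card (pverts G) div 2" "card Y = card (pverts G) div 2"
    using underlying.mantel_extremal[OF underlying.extremal_triangle_free[OF assms(1) m] m] by metis
  show K: "complete_bipartite_digraph (card (pverts G) - card (pverts G) div 2)
      (card (pverts G) div 2) (with_proj H)"
    unfolding complete_bipartite_digraph_pair_def using XY pair_finite_verts
    by (auto simp: H_def)
  show "orientation_of G H"
    unfolding orientation_of_def using pair_graphI_complete_bipartite[OF K] no_2_cycle
    by (auto simp: H_def sym_closure_def)
qed

theorem theorem10:
  shows "(\<forall>n k :: nat. n \<ge> 4 \<and> k \<ge> 2 \<longrightarrow> int (ex_geodetic n k) = \<lfloor>(real n)\<^sup>2 / 4\<rfloor>) \<and>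
    (\<forall>n :: nat. n \<ge> 7 \<longrightarrow>
      (\<forall>D :: 'a pair_pre_digraph.
         pair_digraph D \<and> card (pverts D) = n \<and> k_geodetic 2 D \<and>
         card (parcs D) = ex_geodetic n 2 \<longrightarrow>
         (\<exists>H :: 'a pair_pre_digraph.
            complete_bipartite_digraph (nat \<lceil>real n / 2\<rceil>) (nat \<lfloor>real n / 2\<rfloor>) (with_proj H) \<and>
            orientation_of D H)))"
proof (intro conjI allI impI)
  fix n k :: nat assume "n \<ge> 4 \<and> k \<ge> 2"
  then show "int (ex_geodetic n k) = \<lfloor>(real n)\<^sup>2 / 4\<rfloor>"
    using ex_geodetic_eq floor_divide_of_nat_eq[of "n\<^sup>2" 4, where ?'a = real] by simp
next
  fix n :: nat and D :: "'a pair_pre_digraph"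
  assume n: "n \<ge> 7" and D: "pair_digraph D \<and> card (pverts D) = n \<and> k_geodetic 2 D \<and>
         card (parcs D) = ex_geodetic n 2"
  interpret two_geodetic D using D by (intro two_geodeticI[of D 2]) auto
  have "nat \<lfloor>real n / 2\<rfloor> = n div 2" by linarith
  moreover have "nat \<lceil>real n / 2\<rceil> = n - n div 2" by linarith
  ultimately show "\<exists>H. complete_bipartite_digraph (nat \<lceil>real n / 2\<rceil>) (nat \<lfloor>real n / 2\<rfloor>) (with_proj H) \<and>
            orientation_of D H"
    using extremal_orientation D n ex_geodetic_eq[of n 2] by auto
qed

end
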